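(* Let $G$ be a finite simple undirected graph, $\mathcal{M}$ an MCB of $G$, and $C_1,C_2\in\mathcal{M}$ distinct with $|C_1|\le|C_2|$, such that $C_1$ and $C_2$ share at least one vertex. Then there exist circulations (cyclic traversal directions) of $C_1$ and $C_2$ such that: (1) the intersection of $C_1$ and $C_2$ (common vertices and edges) consists of $k\ge1$ vertex-disjoint paths $P_1,P_2,\ldots,P_k$ (a path may consist of a single vertex) which appear in the same cyclic order and with the same orientation in both traversals; (2) for $i=1,\ldots,k$ and $j=1,2$, letting $Q_i^{(j)}$ be the path in $C_j$ (traversed in the chosen direction) joining the end of $P_i$ to the start of $P_{i+1}$, where $P_{k+1}:=P_1$, the paths can be labeled so that $|Q_i^{(1)}|=|Q_i^{(2)}|$ for $i=1,\ldots,k-1$; $|Q_i^{(j)}|\le|C_1|/2$ for $i=1,\ldots,k-1$, $j=1,2$; $|Q_k^{(2)}|=|Q_k^{(1)}|+|C_2|-|C_1|$; and $|Q_k^{(j)}|\ge|C_j|/2$ for $j=1,2$.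
   Context: Let $G=(V,E)$ be a finite simple undirected graph. A cycle is a set $C\subseteq E$ such that every vertex of $G$ has even degree in the subgraph with edge set $C$; $|C|$ denotes the number of edges, and the length of a path is its number of edges (a single-vertex path has length $0$). The cycles form a vector space over $GF(2)$ under symmetric difference $\oplus$. A minimum cycle basis (MCB) is a basis $\mathcal{M}$ of this space minimizing $\sum_{B\in\mathcal{M}}|B|$. Elements of an MCB are edge sets of simple cycles (circuits) of $G$, and we regard them as cycle graphs. *)

theory Defs
  imports
    Complex_Main
    "HOL-Library.Function_Algebras"
    "HOL-Library.Indicator_Function"
    "HOL-Library.Disjoint_Sets"
    "HOL-Library.Z2"
begin

definition simple_graph :: "'v set \<Rightarrow> 'v set set \<Rightarrow> bool" where
  "simple_graph V E \<longleftrightarrow> finite V \<and> (\<forall>e\<in>E. e \<subseteq> V \<and> card e = 2)"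

definition degree_in :: "'v set set \<Rightarrow> 'v \<Rightarrow> nat" where
  "degree_in C v = card {e \<in> C. v \<in> e}"

definition cycle_space :: "'v set \<Rightarrow> 'v set set \<Rightarrow> 'v set set set" where
  "cycle_space V E = {C. C \<subseteq> E \<and> (\<forall>v\<in>V. even (degree_in C v))}"

(* The GF(2)-vector space of edge sets under symmetric difference is represented by the
   characteristic functions with values in the two-element field bit. *)

definition gf2_scale :: "bit \<Rightarrow> ('e \<Rightarrow> bit) \<Rightarrow> 'e \<Rightarrow> bit" where
  "gf2_scale c f = (\<lambda>e. c * f e)"

interpretation gf2: vector_space "gf2_scale :: bit \<Rightarrow> ('e \<Rightarrow> bit) \<Rightarrow> 'e \<Rightarrow> bit"
  by unfold_locales (auto simp: gf2_scale_def fun_eq_iff algebra_simps)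

definition char_vec :: "'e set \<Rightarrow> 'e \<Rightarrow> bit" where
  "char_vec A = indicator A"

lemma inj_char_vec: "inj char_vec"
  by (auto simp: inj_def char_vec_def fun_eq_iff indicator_def split: if_splits)

lemma char_vec_sym_diff: "char_vec ((A - B) \<union> (B - A)) = char_vec A + char_vec B"
  by (auto simp: char_vec_def fun_eq_iff indicator_def)

definition cycle_basis :: "'v set \<Rightarrow> 'v set set \<Rightarrow> 'v set set set \<Rightarrow> bool" where
  "cycle_basis V E M \<longleftrightarrow>
     M \<subseteq> cycle_space V E \<and>
     gf2.independent (char_vec ` M) \<and>
     gf2.span (char_vec ` M) = char_vec ` cycle_space V E"

definition minimum_cycle_basis :: "'v set \<Rightarrow> 'v set set \<Rightarrow> 'v set set set \<Rightarrow> bool" where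
  "minimum_cycle_basis V E M \<longleftrightarrow>
     cycle_basis V E M \<and>
     (\<forall>M'. cycle_basis V E M' \<longrightarrow> (\<Sum>B\<in>M. card B) \<le> (\<Sum>B\<in>M'. card B))"

(* Walks are given by their nonempty vertex sequences. *)

definition walk_edges :: "'v list \<Rightarrow> 'v set set" where
  "walk_edges p = {{p ! i, p ! Suc i} | i. Suc i < length p}"

definition walk_length :: "'v list \<Rightarrow> nat" where
  "walk_length p = length p - 1"

definition is_path :: "'v set set \<Rightarrow> 'v list \<Rightarrow> bool" where
  "is_path E p \<longleftrightarrow> p \<noteq> [] \<and> distinct p \<and> walk_edges p \<subseteq> E"

(* A traversal of the simple cycle with edge set C: its vertices in cyclic order, without
   repeating the first one at the end. The starting vertex is immaterial; the order of the
   list determines the direction. *)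

definition circulation :: "'v set set \<Rightarrow> 'v list \<Rightarrow> bool" where
  "circulation C c \<longleftrightarrow> 3 \<le> length c \<and> distinct c \<and> walk_edges (c @ [hd c]) = C"

(* The traversal c, read from the start of P 1, runs through P 1, Q 1, P 2, Q 2, ..., P k, Q k
   and then returns to the start of P (k+1) = P 1. Each Q i contains both of its end vertices,
   which belong to P i and P (i+1), so only its inner vertices butlast (tl (Q i)) are
   inserted. If k = 1 and P 1 is a single vertex, Q 1 is the closed walk around the
   whole cycle. *)

definition traverses :: "'v list \<Rightarrow> nat \<Rightarrow> (nat \<Rightarrow> 'v list) \<Rightarrow> (nat \<Rightarrow> 'v list) \<Rightarrow> bool" where
  "traverses c k P Q \<longleftrightarrow>
     P (k + 1) = P 1 \<and>
     (\<forall>i\<in>{1..k}. 2 \<le> length (Q i) \<and> hd (Q i) = last (P i) \<and> last (Q i) = hd (P (i + 1))) \<and>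
     c = concat (map (\<lambda>i. P i @ butlast (tl (Q i))) [1..<k + 1])"

end

theory Submission
  imports Defs
begin

text \<open>By the exchange property, a cycle shorter than \<open>B \<in> M\<close> lies in the span of \<open>M - {B}\<close>. Hence
  \<open>B\<close> is an inclusion-minimal cycle, i.e. a circuit, and its arcs are geodesics of the graph, so the
  cyclic distances of two common vertices in \<open>C\<^sub>1\<close> and in \<open>C\<^sub>2\<close> agree. If all arcs \<open>A\<^sub>i\<close> of \<open>C\<^sub>1\<close>
  between consecutive common vertices were shorter than \<open>|C\<^sub>1|/2\<close>, then, with \<open>B\<^sub>i\<close> a shortest arc of
  \<open>C\<^sub>2\<close> with the same ends, the cycles \<open>A\<^sub>i \<oplus> B\<^sub>i\<close> would be shorter than \<open>C\<^sub>1\<close>, and the sum of the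
  \<open>B\<^sub>i\<close>, a cycle inside \<open>C\<^sub>2\<close>, would be empty or \<open>C\<^sub>2\<close>; so \<open>C\<^sub>1\<close> would lie in the span of
  \<open>M - {C\<^sub>1}\<close>. Thus the common vertices lie on one half of \<open>C\<^sub>1\<close>, and since the distances agree, they
  occupy the same positions on \<open>C\<^sub>2\<close>, suitably started and directed. The paths \<open>P\<^sub>i\<close> are the maximal
  runs of consecutive positions.\<close>

section \<open>Joins\<close>

text \<open>The T-joins of graph theory for \<open>T = {u, v}\<close>; with \<open>u = v\<close> no
  vertex has odd degree, so \<open>join C u u\<close> means that \<open>C\<close> is even. Working
  with parities instead of paths turns concatenation into symmetric difference, whatever edges the
  pieces share.\<close>

definition join :: "'v set set \<Rightarrow> 'v \<Rightarrow> 'v \<Rightarrow> bool" where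
  "join A u v \<longleftrightarrow> finite A \<and> (\<forall>w. odd (degree_in A w) \<longleftrightarrow> (w = u) \<noteq> (w = v))"

lemma odd_degree_sym_diff:
  assumes "finite A" "finite B"
  shows "odd (degree_in (sym_diff A B) w) \<longleftrightarrow> odd (degree_in A w) \<noteq> odd (degree_in B w)"
proof -
  let ?A = "{e \<in> A. w \<in> e}" and ?B = "{e \<in> B. w \<in> e}"
  have fin: "finite ?A" "finite ?B" using assms by auto
  have "{e \<in> sym_diff A B. w \<in> e} = (?A - ?B) \<union> (?B - ?A)" by auto
  moreover have "card ((?A - ?B) \<union> (?B - ?A)) = card (?A - ?B) + card (?B - ?A)"
    using fin by (intro card_Un_disjoint) auto
  ultimately have "degree_in (sym_diff A B) w = card (?A - ?B) + card (?B - ?A)"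
    by (simp only: degree_in_def)
  moreover have "card ?A = card (?A - ?B) + card (?A \<inter> ?B)"
    using card_Diff_subset_Int[of ?A ?B] card_mono[of ?A "?A \<inter> ?B"] fin by auto
  moreover have "card ?B = card (?B - ?A) + card (?A \<inter> ?B)"
    using card_Diff_subset_Int[of ?B ?A] card_mono[of ?B "?A \<inter> ?B"] fin by (auto simp: Int_commute)
  ultimately show ?thesis by (simp add: degree_in_def) presburger
qed

lemma join_finite: "join A u v \<Longrightarrow> finite A"
  by (simp add: join_def)

lemma join_sym: "join A u v \<Longrightarrow> join A v u"
  by (auto simp: join_def)

lemma join_empty: "join {} u u"
  by (simp add: join_def degree_in_def)

lemma join_edge:
  assumes "a \<noteq> b" shows "join {{a, b}} a b"
proof -
  have "{e \<in> {{a, b}}. w \<in> e} = (if w = a \<or> w = b then {{a, b}} else {})" for w by auto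
  thus ?thesis using assms by (auto simp: join_def degree_in_def)
qed

lemma join_trans: "join A u v \<Longrightarrow> join B v w \<Longrightarrow> join (sym_diff A B) u w"
  unfolding join_def using odd_degree_sym_diff[of A B] by blast

lemma join_closed: "join A u u \<Longrightarrow> join A v v"
  by (simp add: join_def)

text \<open>Used for complementary arcs: removing one arc of a circuit leaves the other one, with
  the same ends.\<close>

lemma join_closed_diff:
  assumes "join C u u" "join A v w" "A \<subseteq> C" shows "join (C - A) v w"
proof -
  have "join (sym_diff C A) v w"
    using join_trans[OF join_closed[OF assms(1)] assms(2)] .
  moreover have "sym_diff C A = C - A" using assms(3) by auto
  ultimately show ?thesis by simp
qed

section \<open>Traversals of circuits\<close>

definition cyc_edge :: "'v list \<Rightarrow> nat \<Rightarrow> 'v set" where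
  "cyc_edge c i = {c ! i, c ! (Suc i mod length c)}"

text \<open>Cyclic indices replace the closed list, so that arcs become images of index intervals
  under \<open>cyc_edge\<close>.\<close>

lemma circulation_iff:
  "circulation C c \<longleftrightarrow> 3 \<le> length c \<and> distinct c \<and> C = cyc_edge c ` {..<length c}"
proof (cases "c = []")
  case False
  have "(c @ [hd c]) ! i = c ! (i mod length c)" if "i \<le> length c" for i
    using that False by (cases "i = length c") (auto simp: nth_append hd_conv_nth)
  hence "{(c @ [hd c]) ! i, (c @ [hd c]) ! Suc i} = cyc_edge c i" if "i < length c" for i
    using that by (simp add: cyc_edge_def)
  hence "walk_edges (c @ [hd c]) = cyc_edge c ` {..<length c}"
    unfolding walk_edges_def by (auto simp: image_iff)
  thus ?thesis by (auto simp: circulation_def)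
qed (simp add: circulation_def)

lemma inj_on_cyc_edge:
  assumes "circulation C c" shows "inj_on (cyc_edge c) {..<length c}"
proof (rule inj_onI)
  let ?n = "length c"
  have n: "3 \<le> ?n" and d: "distinct c" using assms by (auto simp: circulation_def)
  fix i j assume ij: "i \<in> {..<?n}" "j \<in> {..<?n}" "cyc_edge c i = cyc_edge c j"
  have lt: "Suc i mod ?n < ?n" "Suc j mod ?n < ?n" using n by (auto intro!: mod_less_divisor)
  from ij(3) consider "c ! i = c ! j" | "c ! i = c ! (Suc j mod ?n)" "c ! j = c ! (Suc i mod ?n)"
    by (auto simp: cyc_edge_def doubleton_eq_iff)
  thus "i = j"
  proof cases
    case 1 thus ?thesis using ij d by (simp add: nth_eq_iff_index_eq)
  next
    \<comment> \<open>Here \<open>i\<close> and \<open>j\<close> would be cyclic successors of each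
      other, which needs length at most 2.\<close>
    case 2
    hence "i = Suc j mod ?n" "j = Suc i mod ?n"
      using ij d lt by (simp_all add: nth_eq_iff_index_eq)
    moreover have "Suc k mod ?n = (if Suc k = ?n then 0 else Suc k)" if "k < ?n" for k
      using that by auto
    ultimately have "i = (if Suc j = ?n then 0 else Suc j)" "j = (if Suc i = ?n then 0 else Suc i)"
      using ij(1,2) by (metis lessThan_iff)+
    hence "i = 0 \<and> Suc j = ?n \<or> i = Suc j" "j = 0 \<and> Suc i = ?n \<or> j = Suc i" by metis+
    thus ?thesis using n by (elim disjE conjE; linarith)
  qed
qed

lemma circulation_card: "circulation C c \<Longrightarrow> card C = length c"
  using inj_on_cyc_edge[of C c] by (simp add: circulation_iff card_image)

lemma circulation_Union:
  assumes "circulation C c" shows "\<Union>C = set c"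
proof -
  have n: "3 \<le> length c" and C: "C = cyc_edge c ` {..<length c}"
    using assms by (auto simp: circulation_iff)
  have "Suc i mod length c < length c" for i using n by (intro mod_less_divisor) auto
  thus ?thesis unfolding C by (force simp: cyc_edge_def in_set_conv_nth)
qed

lemma arc_card:
  assumes "circulation C c" "j \<le> length c"
  shows "card (cyc_edge c ` {i..<j}) = j - i"
  using inj_on_subset[OF inj_on_cyc_edge[OF assms(1)], of "{i..<j}"] assms(2)
  by (force simp: card_image)

lemma arc_subset: "circulation C c \<Longrightarrow> j \<le> length c \<Longrightarrow> cyc_edge c ` {i..<j} \<subseteq> C"
  by (auto simp: circulation_iff)

text \<open>The value \<open>j = length c\<close> is allowed, hence the \<open>mod\<close> at the
  end: it makes the full turn a join from position 0 back to itself.\<close>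

lemma arc_join:
  assumes c: "circulation C c" and "i \<le> j" "j \<le> length c" "i < length c"
  shows "join (cyc_edge c ` {i..<j}) (c ! i) (c ! (j mod length c))"
  using assms(2,3)
proof (induction j rule: dec_induct)
  case base
  thus ?case using assms(4) by (simp add: join_empty)
next
  case (step j)
  let ?n = "length c"
  have j: "j < ?n" and n: "3 \<le> ?n" "distinct c" using step c by (auto simp: circulation_def)
  have "Suc j mod ?n < ?n" using n by (intro mod_less_divisor) auto
  moreover have "Suc j mod ?n \<noteq> j" using j n by (auto simp: mod_Suc)
  ultimately have ne: "c ! j \<noteq> c ! (Suc j mod ?n)" using j n by (simp add: nth_eq_iff_index_eq)
  have "cyc_edge c j \<notin> cyc_edge c ` {i..<j}"
  proof
    assume "cyc_edge c j \<in> cyc_edge c ` {i..<j}"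
    then obtain k where "k \<in> {i..<j}" "cyc_edge c j = cyc_edge c k" by auto
    with inj_onD[OF inj_on_cyc_edge[OF c], of j k] j show False by auto
  qed
  hence "cyc_edge c ` {i..<Suc j} = sym_diff (cyc_edge c ` {i..<j}) {cyc_edge c j}"
    using step(1) by (auto simp: atLeastLessThanSuc)
  moreover have "join (cyc_edge c ` {i..<j}) (c ! i) (c ! j)" using step j by simp
  ultimately show ?case using join_trans[OF _ join_edge[OF ne]] by (simp add: cyc_edge_def)
qed

lemma circulation_join:
  assumes "circulation C c" shows "join C u u"
proof -
  have "0 < length c" using assms by (auto simp: circulation_def)
  with arc_join[OF assms, of 0 "length c"] assms have "join C (c ! 0) (c ! 0)"
    by (auto simp: circulation_iff atLeast0LessThan)
  thus ?thesis by (rule join_closed)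
qed

section \<open>Changing the starting point and the direction of a traversal\<close>

lemma circulation_rotate:
  assumes "circulation C c" shows "circulation C (rotate m c)"
proof -
  let ?n = "length c"
  have n: "3 \<le> ?n" "0 < ?n" "c \<noteq> []" and C: "C = cyc_edge c ` {..<?n}"
    using assms by (auto simp: circulation_iff)
  have e: "cyc_edge (rotate m c) i = cyc_edge c ((m + i) mod ?n)" if "i < ?n" for i
    using that n by (simp add: cyc_edge_def nth_rotate mod_simps)
  have "cyc_edge (rotate m c) ` {..<?n} = cyc_edge c ` ((\<lambda>i. (m + i) mod ?n) ` {..<?n})"
    unfolding image_image by (rule image_cong) (auto simp: e)
  also have "(\<lambda>i. (m + i) mod ?n) ` {..<?n} = {..<?n}"
  proof (rule endo_inj_surj)
    show "inj_on (\<lambda>i. (m + i) mod ?n) {..<?n}"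
    proof (rule linorder_inj_onI')
      fix i j assume ij: "i \<in> {..<?n}" "j \<in> {..<?n}" "i < j"
      show "(m + i) mod ?n \<noteq> (m + j) mod ?n"
      proof
        assume "(m + i) mod ?n = (m + j) mod ?n"
        hence "?n dvd (m + j) - (m + i)" using ij mod_eq_dvd_iff_nat[of "m + i" "m + j" ?n] by auto
        thus False using ij by (auto dest: dvd_imp_le)
      qed
    qed
  qed (use n in auto)
  finally show ?thesis using assms C by (simp add: circulation_iff)
qed

lemma circulation_rev:
  assumes "circulation C c" shows "circulation C (rev c)"
proof -
  let ?n = "length c"
  \<comment> \<open>Edge \<open>i\<close> of \<open>rev c\<close> joins the positions
    \<open>?n - 1 - i\<close> and \<open>?n - 2 - i\<close> of \<open>c\<close>; only the closing
    edge keeps its index. This renumbering is an involution, hence onto.\<close>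
  define g where "g i = (if i = ?n - 1 then ?n - 1 else ?n - 2 - i)" for i
  have n: "3 \<le> ?n" and C: "C = cyc_edge c ` {..<?n}" using assms by (auto simp: circulation_iff)
  have e: "cyc_edge (rev c) i = cyc_edge c (g i)" if "i < ?n" for i
  proof (cases "i = ?n - 1")
    case True
    moreover have "Suc (?n - 1) = ?n" using n by simp
    hence "Suc (?n - 1) mod ?n = 0" by (simp only: mod_self)
    moreover have "0 < ?n" using n by linarith
    ultimately show ?thesis by (simp add: cyc_edge_def g_def rev_nth insert_commute)
  next
    case False
    hence "Suc i mod ?n = Suc i" "Suc (?n - 2 - i) mod ?n = ?n - 1 - i" using that by auto
    thus ?thesis using that False by (auto simp: cyc_edge_def g_def rev_nth numeral_2_eq_2)
  qed
  have "g (g i) = i" if "i < ?n" for i using that n by (auto simp: g_def)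
  moreover have "g i < ?n" if "i < ?n" for i using that n by (auto simp: g_def)
  ultimately have "g ` {..<?n} = {..<?n}" by (force simp: image_iff)
  moreover have "cyc_edge (rev c) ` {..<?n} = cyc_edge c ` (g ` {..<?n})"
    unfolding image_image by (rule image_cong) (auto simp: e)
  ultimately show ?thesis using assms C by (simp add: circulation_iff)
qed

lemma circulation_start_at:
  assumes "circulation C c" "v \<in> \<Union>C"
  obtains c' where "circulation C c'" "c' ! 0 = v"
proof -
  obtain i where i: "i < length c" "c ! i = v"
    using assms by (auto simp: circulation_Union in_set_conv_nth)
  hence "c \<noteq> []" by auto
  hence "rotate i c ! 0 = v" using i by (simp add: nth_rotate)
  thus thesis using that circulation_rotate[OF assms(1)] by blast
qed

text \<open>After reversal the old start is last; rotating by \<open>length c - 1\<close> brings it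
  to the front again, and the other positions are mirrored.\<close>

lemma circulation_reverse_at:
  assumes "circulation C c"
  obtains c' where "circulation C c'" "c' ! 0 = c ! 0"
    "\<And>i. 0 < i \<Longrightarrow> i < length c \<Longrightarrow> c' ! i = c ! (length c - i)"
proof -
  let ?n = "length c" and ?c = "rotate (length c - 1) (rev c)"
  have n: "3 \<le> ?n" using assms by (simp add: circulation_def)
  have nth: "?c ! i = rev c ! ((?n - 1 + i) mod ?n)" if "i < ?n" for i
    using that nth_rotate[of i "rev c" "?n - 1"] by simp
  have "c \<noteq> []" using n by auto
  hence "?c ! 0 = c ! 0" using nth[of 0] by (simp add: rev_nth)
  moreover have "?c ! i = c ! (?n - i)" if "0 < i" "i < ?n" for i
  proof -
    have "?n - 1 + i = i - 1 + ?n" using that by simp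
    hence "(?n - 1 + i) mod ?n = (i - 1) mod ?n" by (simp only: mod_add_self2)
    hence "(?n - 1 + i) mod ?n = i - 1" using that by simp
    thus ?thesis using nth[of i] that by (simp add: rev_nth)
  qed
  ultimately show thesis
    using that circulation_rotate[OF circulation_rev[OF assms]] by blast
qed

text \<open>With truncated subtraction, \<open>i - j + (j - i)\<close> is the absolute difference;
  the minimum is the length of the shorter of the two arcs on a cycle of length
  \<open>n\<close>.\<close>

definition cyc_dist :: "nat \<Rightarrow> nat \<Rightarrow> nat \<Rightarrow> nat" where
  "cyc_dist n i j = min (i - j + (j - i)) (n - (i - j + (j - i)))"

lemma cyc_dist_sym: "cyc_dist n i j = cyc_dist n j i"
  by (simp add: cyc_dist_def add.commute)

lemma circulation_arcs:
  assumes c: "circulation C c" and "i < length c" "j < length c"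
  obtains A where "A \<subseteq> C" "join A (c ! i) (c ! j)" "join (C - A) (c ! i) (c ! j)"
    "card A = cyc_dist (length c) i j" "card A \<le> card (C - A)"
proof -
  have "\<exists>A\<subseteq>C. join A (c ! i) (c ! j) \<and> join (C - A) (c ! i) (c ! j) \<and>
      card A = cyc_dist (length c) i j \<and> card A \<le> card (C - A)"
    if "i \<le> j" "j < length c" for i j
  proof -
    let ?A = "cyc_edge c ` {i..<j}"
    have A: "?A \<subseteq> C" "join ?A (c ! i) (c ! j)" "card ?A = j - i"
      using arc_subset[OF c, of j i] arc_join[OF c, of i j] arc_card[OF c, of j i] that by auto
    have B: "join (C - ?A) (c ! i) (c ! j)"
      using join_closed_diff[OF circulation_join[OF c] A(2,1)] .
    have cB: "card (C - ?A) = length c - (j - i)"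
      using card_Diff_subset[of ?A C] A circulation_card[OF c] by auto
    show ?thesis
    \<comment> \<open>The witness is the arc from \<open>i\<close> to \<open>j\<close> if that is at
      most half of the circuit, otherwise its complement.\<close>
    proof (cases "2 * (j - i) \<le> length c")
      case True
      thus ?thesis using A B cB that
        by (intro exI[of _ ?A]) (auto simp: cyc_dist_def min_def)
    next
      case False
      moreover have "C - (C - ?A) = ?A" using A by auto
      ultimately show ?thesis using A B cB that
        by (intro exI[of _ "C - ?A"]) (auto simp: cyc_dist_def min_def)
    qed
  qed
  from this[of i j] this[of j i] show thesis
    using assms(2,3) that cyc_dist_sym join_sym by (metis nat_le_linear)
qed

text \<open>Longest path argument: the first vertex of a longest path has a second incident edge by
  parity, and its other end must lie on the path, which closes a circuit.\<close>

lemma even_graph_contains_circuit: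
  assumes fin: "finite C" and ne: "C \<noteq> {}" and two: "\<And>e. e \<in> C \<Longrightarrow> card e = 2"
    and even: "\<And>v. even (degree_in C v)"
  obtains D c where "D \<subseteq> C" "circulation D c"
proof -
  define S where "S = {p. is_path C p \<and> 2 \<le> length p}"
  have walk: "{p ! i, p ! Suc i} \<in> C" if "is_path C p" "Suc i < length p" for p i
    using that by (auto simp: is_path_def walk_edges_def)
  have verts: "set p \<subseteq> \<Union>C" if "p \<in> S" for p
  proof
    fix v assume "v \<in> set p"
    then obtain i where i: "i < length p" "p ! i = v" by (auto simp: in_set_conv_nth)
    show "v \<in> \<Union>C"
    proof (cases "Suc i < length p")
      case True
      thus ?thesis using walk[of p i] i that by (auto simp: S_def)
    next
      case False
      with that i have "0 < i" by (auto simp: S_def)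
      then obtain k where "i = Suc k" using gr0_implies_Suc by blast
      thus ?thesis using walk[of p k] i that by (auto simp: S_def)
    qed
  qed
  \<comment> \<open>The number of vertices bounds the length of the lists in \<open>S\<close>, so a
    longest one exists.\<close>
  have finU: "finite (\<Union>C)" using fin two by (intro finite_Union) (auto intro: card_ge_0_finite)
  have bound: "length p \<le> card (\<Union>C)" if "p \<in> S" for p
    using card_mono[OF finU verts[OF that]] that by (simp add: S_def is_path_def distinct_card)
  obtain e where "e \<in> C" using ne by auto
  then obtain a b where "{a, b} \<in> C" "a \<noteq> b" using two by (metis card_2_iff)
  hence "[a, b] \<in> S" by (auto simp: S_def is_path_def walk_edges_def less_Suc_eq)
  then obtain p where p: "p \<in> S" and max: "\<And>q. q \<in> S \<Longrightarrow> length q \<le> length p"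
    using ex_has_greatest_nat[of "\<lambda>p. p \<in> S" "[a, b]" length "Suc (card (\<Union>C))"] bound
    by (auto simp: less_Suc_eq_le)
  then obtain x y r where xy: "p = x # y # r"
    by (cases p; cases "tl p") (auto simp: S_def)
  have pd: "distinct p" and pC: "is_path C p" using p by (auto simp: S_def is_path_def)
  have xyC: "{x, y} \<in> C" using walk[OF pC, of 0] xy by simp
  have "\<exists>e\<in>C. x \<in> e \<and> e \<noteq> {x, y}"
  proof (rule ccontr)
    assume "\<not> ?thesis"
    hence "{e \<in> C. x \<in> e} = {{x, y}}" using xyC by blast
    thus False using even[of x] by (simp add: degree_in_def)
  qed
  then obtain e where e: "e \<in> C" "x \<in> e" "e \<noteq> {x, y}" by auto
  then obtain z where z: "e = {x, z}" "z \<noteq> x" using two[of e] by (auto simp: card_2_iff)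
  have "z \<in> set p"
  proof (rule ccontr)
    assume "z \<notin> set p"
    moreover have "{(z # p) ! i, (z # p) ! Suc i} \<in> C" if "Suc i < length (z # p)" for i
      using that walk[OF pC, of "i - 1"] e z xy
      by (cases i) (auto simp: insert_commute)
    ultimately have "z # p \<in> S" using pd p by (auto simp: S_def is_path_def walk_edges_def)
    thus False using max by fastforce
  qed
  then obtain j where j: "j < length p" "p ! j = z" by (auto simp: in_set_conv_nth)
  \<comment> \<open>Position 0 is \<open>x\<close> itself and position 1 is \<open>y\<close>, whose
    edge to \<open>x\<close> differs from \<open>e\<close>. So the first \<open>Suc j\<close>
    vertices form a circuit with at least three vertices.\<close>
  have j2: "2 \<le> j"
  proof (rule ccontr)
    assume "\<not> 2 \<le> j"
    hence "j = 0 \<or> j = 1" by auto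
    thus False using j z e xy by auto
  qed
  let ?c = "take (Suc j) p"
  have len: "length ?c = Suc j" using j by simp
  have "cyc_edge ?c i \<in> C" if "i < Suc j" for i
  proof (cases "i = j")
    case True
    have "p ! 0 = x" using xy by simp
    hence "cyc_edge ?c j = {z, x}" using j len by (simp add: cyc_edge_def)
    thus ?thesis using True e z by (simp add: insert_commute)
  next
    case False
    hence "Suc i < Suc j" using that False by simp
    thus ?thesis using walk[OF pC, of i] j len by (simp add: cyc_edge_def)
  qed
  hence "cyc_edge ?c ` {..<length ?c} \<subseteq> C" using len by auto
  moreover have "circulation (cyc_edge ?c ` {..<length ?c}) ?c"
    using len j2 pd by (simp add: circulation_iff)
  ultimately show thesis using that by blast
qed

section \<open>Minimum cycle bases\<close>

locale mcb =
  fixes V :: "'v set" and E :: "'v set set" and M :: "'v set set set"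
  assumes graph: "simple_graph V E" and min_basis: "minimum_cycle_basis V E M"
begin

abbreviation span_without :: "'v set set \<Rightarrow> ('v set \<Rightarrow> bit) set" where
  "span_without B \<equiv> gf2.span (char_vec ` (M - {B}))"

lemma finite_E: "finite E"
proof -
  have "E \<subseteq> Pow V" "finite V" using graph by (auto simp: simple_graph_def)
  thus ?thesis by (meson finite_Pow_iff finite_subset)
qed

lemma basis: "cycle_basis V E M"
  using min_basis by (simp add: minimum_cycle_basis_def)

lemma M_cycle: "B \<in> M \<Longrightarrow> B \<in> cycle_space V E"
  using basis by (auto simp: cycle_basis_def)

lemma M_edges: "B \<in> M \<Longrightarrow> B \<subseteq> E"
  using M_cycle by (auto simp: cycle_space_def)

lemma finite_M: "finite M"
proof -
  have "M \<subseteq> Pow E" using M_edges by auto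
  thus ?thesis using finite_E by (meson finite_Pow_iff finite_subset)
qed

text \<open>Edges lie inside \<open>V\<close>, so vertices outside have degree 0 and evenness on
  \<open>V\<close> is evenness everywhere. The base vertex \<open>u\<close> is arbitrary.\<close>

lemma cycle_space_iff: "X \<in> cycle_space V E \<longleftrightarrow> X \<subseteq> E \<and> join X u u"
proof
  assume X: "X \<in> cycle_space V E"
  hence XE: "X \<subseteq> E" by (simp add: cycle_space_def)
  have "even (degree_in X w)" for w
  proof (cases "w \<in> V")
    case False
    hence "{e \<in> X. w \<in> e} = {}" using XE graph by (auto simp: simple_graph_def)
    thus ?thesis by (simp only: degree_in_def) simp
  qed (use X in \<open>auto simp: cycle_space_def\<close>)
  thus "X \<subseteq> E \<and> join X u u" using XE finite_subset[OF XE finite_E] by (simp add: join_def)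
qed (auto simp: cycle_space_def join_def)

lemma char_vec_image_diff: "char_vec ` M - {char_vec B} = char_vec ` (M - {B})"
  using inj_char_vec by (auto dest: injD)

lemma not_in_span_without:
  assumes "B \<in> M" shows "char_vec B \<notin> span_without B"
  using basis assms char_vec_image_diff[of B]
  unfolding cycle_basis_def gf2.dependent_def by (metis imageI)

text \<open>Otherwise exchanging \<open>B\<close> for the shorter cycle would give a basis of smaller total length.\<close>

lemma shorter_in_span_without:
  assumes B: "B \<in> M" and X: "X \<in> cycle_space V E" and less: "card X < card B"
  shows "char_vec X \<in> span_without B"
proof (rule ccontr)
  assume nX: "char_vec X \<notin> span_without B"
  let ?N = "insert X (M - {B})"
  let ?r = "char_vec ` (M - {B})"
  have ind: "gf2.independent (char_vec ` M)"
    and sp: "gf2.span (char_vec ` M) = char_vec ` cycle_space V E"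
    using basis by (auto simp: cycle_basis_def)
  have M: "char_vec ` M = insert (char_vec B) ?r" using B by auto
  have N: "char_vec ` ?N = insert (char_vec X) ?r" by auto
  have "gf2.independent ?r" using ind gf2.independent_mono[of "char_vec ` M" ?r] by auto
  hence "gf2.independent (char_vec ` ?N)" unfolding N using nX by (rule gf2.independent_insertI[rotated])
  moreover have XM: "char_vec X \<in> gf2.span (insert (char_vec B) ?r)"
    using sp X M by auto
  have "char_vec B \<in> gf2.span (insert (char_vec X) ?r)"
    using gf2.in_span_insert[OF XM nX] .
  hence "gf2.span (char_vec ` ?N) = gf2.span (char_vec ` M)"
    unfolding N M using XM
    by (intro gf2.span_eq[THEN iffD2]) (auto intro: gf2.span_base)
  ultimately have "cycle_basis V E ?N"
    using sp X M_cycle by (auto simp: cycle_basis_def)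
  hence "(\<Sum>C\<in>M. card C) \<le> (\<Sum>C\<in>?N. card C)"
    using min_basis unfolding minimum_cycle_basis_def by blast
  \<comment> \<open>Since \<open>X\<close> is new, the exchange replaces \<open>card B\<close> by
    exactly \<open>card X\<close> in the total.\<close>
  moreover have "X \<notin> M - {B}" using nX gf2.span_base[of "char_vec X" ?r] by auto
  hence "(\<Sum>C\<in>?N. card C) = card X + (\<Sum>C\<in>M - {B}. card C)" using finite_M by simp
  moreover have "(\<Sum>C\<in>M. card C) = card B + (\<Sum>C\<in>M - {B}. card C)"
    using B finite_M by (simp add: sum.remove)
  ultimately show False using less by simp
qed

text \<open>Both summands lie in the span of \<open>M - {B}\<close>, hence so would
  \<open>B\<close>. Minimality enters the next arguments in this form.\<close>

lemma not_sum_of_shorter: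
  assumes B: "B \<in> M" and "X \<in> cycle_space V E" "Y \<in> cycle_space V E"
    and "card X < card B" "card Y < card B" and "B = sym_diff X Y"
  shows False
proof -
  have "char_vec B = char_vec X + char_vec Y" by (simp only: assms(6) char_vec_sym_diff)
  hence "char_vec B \<in> span_without B"
    using shorter_in_span_without assms by (auto intro: gf2.span_add)
  thus False using not_in_span_without[OF B] by simp
qed

section \<open>Basis elements are circuits\<close>

lemma M_minimal:
  assumes B: "B \<in> M" and X: "X \<in> cycle_space V E" and "X \<subseteq> B"
  shows "X = {} \<or> X = B"
proof (rule ccontr)
  assume *: "\<not> ?thesis"
  have fin: "finite B" using M_edges[OF B] finite_E finite_subset by blast
  have "X \<subseteq> E" "join X undefined undefined" "join B undefined undefined"
    using X M_cycle[OF B] by (auto simp: cycle_space_iff[of _ undefined])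
  \<comment> \<open>A proper nonempty subcycle \<open>X\<close> would split \<open>B\<close> into
    the two shorter cycles \<open>X\<close> and \<open>B - X\<close>. The term
    \<open>undefined\<close> is just some base vertex.\<close>
  hence "B - X \<in> cycle_space V E"
    using M_edges[OF B] join_closed_diff[of B undefined X] \<open>X \<subseteq> B\<close>
    by (auto simp: cycle_space_iff[of _ undefined])
  moreover have "B = sym_diff X (B - X)" using \<open>X \<subseteq> B\<close> by auto
  moreover have "card X < card B" "card (B - X) < card B"
    using * \<open>X \<subseteq> B\<close> fin by (auto intro!: psubset_card_mono)
  ultimately show False using not_sum_of_shorter[OF B X] by blast
qed

lemma M_nonempty:
  assumes "B \<in> M" shows "B \<noteq> {}"
proof
  assume "B = {}"
  hence "char_vec B = 0" by (auto simp: char_vec_def indicator_def)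
  thus False using not_in_span_without[OF assms] by (simp add: gf2.span_zero)
qed

lemma M_circuit:
  assumes B: "B \<in> M" obtains c where "circulation B c"
proof -
  have BE: "B \<subseteq> E" "join B u u" for u using M_cycle[OF B] cycle_space_iff by blast+
  obtain D c where D: "D \<subseteq> B" "circulation D c"
  proof (rule even_graph_contains_circuit[of B])
    show "finite B" "even (degree_in B v)" for v using BE by (auto simp: join_def)
    show "card e = 2" if "e \<in> B" for e using that BE graph by (auto simp: simple_graph_def)
  qed (use M_nonempty[OF B] in auto)
  have "D \<in> cycle_space V E"
    using D BE circulation_join[OF D(2)] by (auto simp: cycle_space_iff[of _ undefined])
  moreover have "D \<noteq> {}" using circulation_card[OF D(2)] D(2) by (auto simp: circulation_def)
  ultimately have "D = B" using M_minimal[OF B] D by auto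
  thus thesis using that D by simp
qed

text \<open>If \<open>X\<close> were smaller than the shorter arc \<open>A\<close>, closing up each
  of \<open>A\<close> and \<open>B - A\<close> with \<open>X\<close> would give two cycles shorter
  than \<open>B\<close>; in their sum \<open>X\<close> cancels and \<open>B\<close> remains.\<close>

lemma M_isometric:
  assumes B: "B \<in> M" and c: "circulation B c" and ij: "i < length c" "j < length c"
    and X: "X \<subseteq> E" "join X (c ! i) (c ! j)"
  shows "cyc_dist (length c) i j \<le> card X"
proof (rule ccontr)
  assume less: "\<not> ?thesis"
  obtain A where A: "A \<subseteq> B" "join A (c ! i) (c ! j)" "join (B - A) (c ! i) (c ! j)"
    "card A = cyc_dist (length c) i j" "card A \<le> card (B - A)"
    using circulation_arcs[OF c ij] by blast
  have fin: "finite A" "finite B" "finite X"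
    using A(2) X(2) finite_subset[OF M_edges[OF B] finite_E] by (auto dest: join_finite)
  have AB: "card A + card (B - A) = card B"
    using fin A by (metis card_Diff_subset card_mono le_add_diff_inverse)
  have "sym_diff A' X \<in> cycle_space V E" "card (sym_diff A' X) \<le> card A' + card X"
    if "A' \<subseteq> B" "join A' (c ! i) (c ! j)" for A'
  proof -
    have "join (sym_diff A' X) (c ! i) (c ! i)" using join_trans[OF that(2) join_sym[OF X(2)]] .
    thus "sym_diff A' X \<in> cycle_space V E"
      using that M_edges[OF B] X(1) cycle_space_iff by (metis Diff_subset Un_least subset_trans)
    have "finite A'" using that fin finite_subset by blast
    hence "card (sym_diff A' X) \<le> card (A' \<union> X)" using fin by (intro card_mono) auto
    thus "card (sym_diff A' X) \<le> card A' + card X" using card_Un_le le_trans by blast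
  qed
  from this[of A] this[of "B - A"]
  have "sym_diff A X \<in> cycle_space V E" "card (sym_diff A X) < card B"
    "sym_diff (B - A) X \<in> cycle_space V E" "card (sym_diff (B - A) X) < card B"
    using A AB less by auto
  moreover have "B = sym_diff (sym_diff A X) (sym_diff (B - A) X)" using A(1) by blast
  ultimately show False using not_sum_of_shorter[OF B] by blast
qed

text \<open>The shorter arc in either circuit is a join in the graph, so it competes with the arcs
  of the other circuit in \<open>M_isometric\<close>.\<close>

lemma M_cyc_dist_eq:
  assumes "C \<in> M" "D \<in> M" and c: "circulation C c" "circulation D d"
    and "i < length c" "j < length c" "i' < length d" "j' < length d"
    and "c ! i = d ! i'" "c ! j = d ! j'"
  shows "cyc_dist (length c) i j = cyc_dist (length d) i' j'"
proof (rule antisym)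
  obtain A where "A \<subseteq> C" "join A (c ! i) (c ! j)" "card A = cyc_dist (length c) i j"
    using circulation_arcs[OF c(1) assms(5,6)] by blast
  thus "cyc_dist (length d) i' j' \<le> cyc_dist (length c) i j"
    using M_isometric[OF assms(2) c(2) assms(7,8)] M_edges[OF assms(1)] assms(9,10) by (metis subset_trans)
  obtain A where "A \<subseteq> D" "join A (d ! i') (d ! j')" "card A = cyc_dist (length d) i' j'"
    using circulation_arcs[OF c(2) assms(7,8)] by blast
  thus "cyc_dist (length c) i j \<le> cyc_dist (length d) i' j'"
    using M_isometric[OF assms(1) c(1) assms(5,6)] M_edges[OF assms(2)] assms(9,10) by (metis subset_trans)
qed

text \<open>Position \<open>t\<close> is the end of a gap: all common vertices before it are at
  least half a turn behind. The value \<open>t = length c\<close> stands for the return to the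
  start.\<close>

lemma M_big_gap:
  assumes C: "C \<in> M" "D \<in> M" "C \<noteq> D" and c: "circulation C c" and d: "circulation D d"
    and start: "c ! 0 \<in> set d"
  obtains t where "0 < t" "t \<le> length c" "c ! (t mod length c) \<in> set d"
    "\<And>s. s < t \<Longrightarrow> c ! s \<in> set d \<Longrightarrow> length c \<le> 2 * (t - s)"
proof (rule ccontr)
  let ?n = "length c"
  note choose = that
  assume "\<not> thesis"
  \<comment> \<open>Otherwise each common position after 0 has an earlier one less than half a turn
    behind it.\<close>
  hence gap: "\<exists>s<t. c ! s \<in> set d \<and> 2 * (t - s) < ?n"
    if "0 < t" "t \<le> ?n" "c ! (t mod ?n) \<in> set d" for t
    using choose[OF that] \<open>\<not> thesis\<close> by (meson not_le)
  have n: "0 < ?n" using c by (auto simp: circulation_def)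
  \<comment> \<open>Going back along these short arcs to position 0, \<open>B\<close> collects the
    matching arcs of \<open>D\<close>.\<close>
  have tele: "\<exists>B\<subseteq>D. join B (c ! 0) (c ! (t mod ?n)) \<and>
      char_vec (cyc_edge c ` {0..<t}) + char_vec B \<in> span_without C"
    if "t \<le> ?n" "c ! (t mod ?n) \<in> set d" for t
    using that
  proof (induction t rule: less_induct)
    case (less t)
    show ?case
    proof (cases "t = 0")
      case True
      have "char_vec {} = (0 :: 'v set \<Rightarrow> bit)" by (auto simp: char_vec_def indicator_def)
      hence "char_vec {} + char_vec {} \<in> span_without C" by (simp only: add_0 gf2.span_zero)
      moreover have "join {} (c ! 0) (c ! (t mod ?n))" using True by (simp add: join_empty)
      moreover have "cyc_edge c ` {0..<t} = {}" using True by simp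
      ultimately show ?thesis by (metis empty_subsetI)
    next
      case False
      then obtain s where s: "s < t" "c ! s \<in> set d" "2 * (t - s) < ?n" using gap less.prems by blast
      hence sn: "s < ?n" using less.prems by simp
      obtain B where B: "B \<subseteq> D" "join B (c ! 0) (c ! s)"
        "char_vec (cyc_edge c ` {0..<s}) + char_vec B \<in> span_without C"
        using less.IH[OF s(1)] s(2) sn by (metis less_imp_le mod_less)
      let ?A = "cyc_edge c ` {s..<t}"
      have A: "?A \<subseteq> C" "join ?A (c ! s) (c ! (t mod ?n))" "card ?A = t - s"
        using arc_subset[OF c, of t s] arc_join[OF c, of s t] arc_card[OF c, of t s] less.prems s(1) sn
        by auto
      obtain i j where ij: "i < length d" "d ! i = c ! s" "j < length d" "d ! j = c ! (t mod ?n)"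
        using s less.prems by (metis in_set_conv_nth)
      \<comment> \<open>The shorter arc of \<open>D\<close> with the ends of \<open>?A\<close> is a
        geodesic, hence no longer than \<open>?A\<close>. Together they form a cycle with at most
        \<open>2 * (t - s) < ?n\<close> edges, so it lies in the span.\<close>
      obtain X where X: "X \<subseteq> D" "join X (c ! s) (c ! (t mod ?n))" "card X = cyc_dist (length d) i j"
        using circulation_arcs[OF d ij(1,3)] ij by metis
      have "?A \<subseteq> E" using A M_edges[OF C(1)] by blast
      hence "card X \<le> card ?A"
        using M_isometric[OF C(2) d ij(1,3), of ?A] A X ij by metis
      moreover have "card (sym_diff ?A X) \<le> card (?A \<union> X)"
        using X A by (intro card_mono) (auto dest: join_finite)
      ultimately have "card (sym_diff ?A X) < card C"
        using A s card_Un_le[of ?A X] circulation_card[OF c] by linarith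
      moreover have "sym_diff ?A X \<in> cycle_space V E"
        using join_trans[OF A(2) join_sym[OF X(2)]] A(1) X(1) M_edges C cycle_space_iff
        by (metis Diff_subset Un_least subset_trans)
      ultimately have AX: "char_vec (sym_diff ?A X) \<in> span_without C"
        using shorter_in_span_without[OF C(1)] by blast
      have "cyc_edge c ` {0..<s} \<inter> ?A = {}"
        using inj_on_image_Int[OF inj_on_cyc_edge[OF c], of "{0..<s}" "{s..<t}"] less.prems sn
        by (auto simp: subset_iff)
      hence "cyc_edge c ` {0..<t} = sym_diff (cyc_edge c ` {0..<s}) ?A"
        using s by (auto simp flip: ivl_disj_un_two(3)[of 0 s t])
      hence "char_vec (cyc_edge c ` {0..<t}) + char_vec (sym_diff B X) =
          (char_vec (cyc_edge c ` {0..<s}) + char_vec B) + char_vec (sym_diff ?A X)"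
        by (simp only: char_vec_sym_diff) (simp add: algebra_simps)
      hence "char_vec (cyc_edge c ` {0..<t}) + char_vec (sym_diff B X) \<in> span_without C"
        using gf2.span_add[OF B(3) AX] by simp
      moreover have "sym_diff B X \<subseteq> D" using B X by auto
      ultimately show ?thesis using join_trans[OF B(2) X(2)] by blast
    qed
  qed
  \<comment> \<open>After the full turn the prefix is all of \<open>C\<close>, and \<open>B\<close>
    is a cycle inside \<open>D\<close>, hence empty or \<open>D\<close>. Either way
    \<open>char_vec B\<close> lies in the span, because \<open>D\<close> differs from
    \<open>C\<close>.\<close>
  have "C = cyc_edge c ` {0..<?n}" using c by (simp add: circulation_iff atLeast0LessThan)
  with tele[of ?n] start n obtain B where B: "B \<subseteq> D" "join B (c ! 0) (c ! 0)"
    "char_vec C + char_vec B \<in> span_without C" by auto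
  have "B \<in> cycle_space V E" using B M_edges[OF C(2)] cycle_space_iff by blast
  hence "B = {} \<or> B = D" using M_minimal[OF C(2)] B by blast
  moreover have "char_vec {} = (0 :: 'v set \<Rightarrow> bit)" by (auto simp: char_vec_def indicator_def)
  ultimately have "char_vec B \<in> span_without C"
    using C by (auto intro: gf2.span_base gf2.span_zero)
  hence "char_vec C \<in> span_without C" using B(3) gf2.span_diff by fastforce
  thus False using not_in_span_without[OF C(1)] by simp
qed

text \<open>Starting \<open>C\<close> right after a gap of at least half its length puts all common vertices into the
  first half.\<close>

lemma M_half:
  assumes C: "C \<in> M" "D \<in> M" "C \<noteq> D" and meet: "\<Union>C \<inter> \<Union>D \<noteq> {}"
  obtains c where "circulation C c" "c ! 0 \<in> \<Union>D"
    "\<And>x. x < length c \<Longrightarrow> c ! x \<in> \<Union>D \<Longrightarrow> 2 * x \<le> length c"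
proof -
  obtain d where d: "circulation D d" using M_circuit[OF C(2)] by blast
  obtain v where v: "v \<in> \<Union>C" "v \<in> \<Union>D" using meet by auto
  obtain c0 where "circulation C c0" using M_circuit[OF C(1)] by blast
  then obtain c where c: "circulation C c" "c ! 0 = v"
    by (rule circulation_start_at[OF _ v(1)])
  let ?n = "length c"
  have UD: "\<Union>D = set d" by (rule circulation_Union[OF d])
  have n: "0 < ?n" "c \<noteq> []" using c by (auto simp: circulation_def)
  have "c ! 0 \<in> set d" using v c UD by simp
  then obtain t where t: "0 < t" "t \<le> ?n" "c ! (t mod ?n) \<in> set d"
    "\<And>s. s < t \<Longrightarrow> c ! s \<in> set d \<Longrightarrow> ?n \<le> 2 * (t - s)"
    using M_big_gap[OF C c(1) d] by blast
  have nt: "?n \<le> 2 * t" using t(4)[of 0] t(1) \<open>c ! 0 \<in> set d\<close> by simp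
  \<comment> \<open>Position \<open>x\<close> after rotation is position \<open>t + x\<close> of
    \<open>c\<close>. Without wrap-around, \<open>x < ?n - t\<close> is at most half of
    \<open>?n\<close>; with it, the old position \<open>t + x - ?n\<close> lies before
    \<open>t\<close>, and the gap bound reads \<open>?n \<le> 2 * (?n - x)\<close>.\<close>
  have "2 * x \<le> ?n" if x: "x < ?n" "rotate t c ! x \<in> set d" for x
  proof (cases "t + x < ?n")
    case False
    hence "(t + x) mod ?n = t + x - ?n" using x t False by (simp add: le_mod_geq)
    hence "c ! (t + x - ?n) \<in> set d" using x nth_rotate[of x c t] by simp
    hence "?n \<le> 2 * (t - (t + x - ?n))" using t(4)[of "t + x - ?n"] t(1) x(1) by linarith
    thus ?thesis using x False by arith
  qed (use nt in linarith)
  moreover have "rotate t c ! 0 \<in> set d" using t n by (simp add: nth_rotate)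
  ultimately show thesis
    using that[of "rotate t c"] circulation_rotate[OF c(1)] UD by simp
qed

text \<open>Distances to the common start fix each common vertex on \<open>D\<close> up to
  reflection. The first common vertex after the start selects the direction, and distances to it
  then settle all others.\<close>

lemma M_aligned:
  assumes C: "C \<in> M" "D \<in> M" "C \<noteq> D" and meet: "\<Union>C \<inter> \<Union>D \<noteq> {}" and le: "card C \<le> card D"
  obtains c d where "circulation C c" "circulation D d" "c ! 0 \<in> \<Union>D"
    "\<And>x. x < length c \<Longrightarrow> c ! x \<in> \<Union>D \<Longrightarrow> 2 * x \<le> length c"
    "\<And>x. x < length c \<Longrightarrow> c ! x \<in> \<Union>D \<Longrightarrow> d ! x = c ! x"
proof -
  obtain c where c: "circulation C c" "c ! 0 \<in> \<Union>D"
    and half: "\<And>x. x < length c \<Longrightarrow> c ! x \<in> \<Union>D \<Longrightarrow> 2 * x \<le> length c"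
    using M_half[OF C meet] by blast
  obtain d0 where d0: "circulation D d0" "d0 ! 0 = c ! 0"
    using M_circuit[OF C(2)] circulation_start_at c(2) by metis
  let ?n = "length c" and ?m = "length d0"
  have len: "length d = ?m" if "circulation D d" for d
    using circulation_card[OF that] circulation_card[OF d0(1)] by simp
  have nm: "?n \<le> ?m" using le circulation_card[OF c(1)] circulation_card[OF d0(1)] by simp
  have n0: "0 < ?n" "0 < ?m" "3 \<le> ?m" using c d0 by (auto simp: circulation_def)
  define I where "I = {x. 0 < x \<and> x < ?n \<and> c ! x \<in> \<Union>D}"
  have pos: "\<exists>y<?m. d ! y = c ! x \<and> (y = x \<or> y = ?m - x)"
    if d: "circulation D d" "d ! 0 = c ! 0" and x: "x \<in> I" for d x
  proof -
    obtain y where y: "y < ?m" "d ! y = c ! x"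
      using x circulation_Union[OF d(1)] len[OF d(1)] by (auto simp: I_def in_set_conv_nth)
    have "cyc_dist ?n 0 x = cyc_dist ?m 0 y"
      using M_cyc_dist_eq[OF C(1,2) c(1) d(1), of 0 x 0 y] len[OF d(1)] d x y n0 by (auto simp: I_def)
    moreover have "2 * x \<le> ?n" "0 < x" using half x by (auto simp: I_def)
    \<comment> \<open>As \<open>x\<close> lies in the first half of \<open>C\<close>, its distance
      from 0 is \<open>x\<close> itself, and only two positions of \<open>D\<close> are that far
      from 0.\<close>
    ultimately have "y = x \<or> y = ?m - x" using y by (auto simp: cyc_dist_def min_def split: if_splits)
    thus ?thesis using y by blast
  qed
  obtain d where d: "circulation D d" "d ! 0 = c ! 0"
    and first: "I \<noteq> {} \<Longrightarrow> d ! Min I = c ! Min I"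
  proof (cases "I = {}")
    case False
    have "finite I" by (simp add: I_def)
    hence M: "Min I \<in> I" using False by simp
    obtain y where y: "y < ?m" "d0 ! y = c ! Min I" "y = Min I \<or> y = ?m - Min I"
      using pos[OF d0 M] by blast
    show thesis
    proof (cases "y = Min I")
      case True thus thesis using that d0 y by blast
    next
      case neq: False
      obtain d' where "circulation D d'" "d' ! 0 = d0 ! 0"
        "\<And>i. 0 < i \<Longrightarrow> i < ?m \<Longrightarrow> d' ! i = d0 ! (?m - i)"
        using circulation_reverse_at[OF d0(1)] by blast
      thus thesis using that[of d'] y neq M nm d0 by (auto simp: I_def)
    qed
  qed (use that d0 in blast)
  have "d ! x = c ! x" if x: "x < ?n" "c ! x \<in> \<Union>D" for x
  proof (cases "x = 0")
    case True thus ?thesis using d by simp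
  next
    case False
    hence xI: "x \<in> I" using x by (simp add: I_def)
    have finI: "finite I" "I \<noteq> {}" using xI by (auto simp: I_def)
    define z where "z = Min I"
    have z: "z \<in> I" "z \<le> x" "d ! z = c ! z" using xI finI first Min_in[OF finI] Min_le[OF finI(1)]
      by (auto simp: z_def)
    obtain y where y: "y < ?m" "d ! y = c ! x" "y = x \<or> y = ?m - x" using pos[OF d xI] by blast
    have "cyc_dist ?n z x = cyc_dist ?m z y"
      using M_cyc_dist_eq[OF C(1,2) c(1) d(1), of z x z y] len[OF d(1)] x y z nm by (auto simp: I_def)
    moreover have "2 * x \<le> ?n" "0 < z" using half x z by (auto simp: I_def)
    \<comment> \<open>The mirrored position \<open>?m - x\<close> has distance \<open>x + z\<close>
      or \<open>?m - x - z\<close> from \<open>z\<close>. Equality with \<open>x - z\<close> forces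
      \<open>2 * x = ?m\<close> because \<open>0 < z\<close>, and then both positions
      coincide.\<close>
    ultimately have "z = x \<or> y = x" using y(1,3) z(2) nm x(1)
      by (auto simp: cyc_dist_def min_def split: if_splits)
    thus ?thesis using y z by auto
  qed
  thus thesis using that c d half by blast
qed

end


section \<open>Decomposition into runs\<close>

text \<open>The \<open>Suc\<close> in the separation condition leaves a missing number between two
  intervals. It makes the runs maximal, which later keeps every common edge within one path.\<close>

definition runs :: "nat set \<Rightarrow> nat \<Rightarrow> (nat \<Rightarrow> nat) \<Rightarrow> (nat \<Rightarrow> nat) \<Rightarrow> bool" where
  "runs I k s t \<longleftrightarrow> 1 \<le> k \<and> s 1 = Min I \<and> t k = Max I \<and> (\<forall>i\<in>{1..k}. s i \<le> t i) \<and>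
    (\<forall>i\<in>{1..k}. \<forall>j\<in>{1..k}. i < j \<longrightarrow> Suc (t i) < s j) \<and> I = (\<Union>i\<in>{1..k}. {s i..t i})"

text \<open>Elements are inserted in increasing order: a new maximum either prolongs the last run or
  opens a new one.\<close>

lemma ex_runs:
  assumes "finite I" "I \<noteq> {}"
  shows "\<exists>k s t. runs I k s t"
  using assms
proof (induction I rule: finite_linorder_max_induct)
  case (insert b A)
  show ?case
  proof (cases "A = {}")
    case True
    thus ?thesis by (intro exI[of _ 1] exI[of _ "\<lambda>_. b"]) (auto simp: runs_def)
  next
    case False
    then obtain k s t where "runs A k s t" using insert.IH by blast
    hence k: "1 \<le> k" "s 1 = Min A" "t k = Max A" "\<forall>i\<in>{1..k}. s i \<le> t i"
      "\<forall>i\<in>{1..k}. \<forall>j\<in>{1..k}. i < j \<longrightarrow> Suc (t i) < s j" "A = (\<Union>i\<in>{1..k}. {s i..t i})"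
      unfolding runs_def by blast+
    have t: "t i \<le> Max A" if "i \<in> {1..k}" for i
    proof -
      have "t i \<in> {s i..t i}" using k(4) that by simp
      hence "t i \<in> A" using k(6) that by blast
      thus ?thesis using insert(1) by simp
    qed
    have b: "Max A < b" "Min A < b" using insert(1,2) False by simp_all
    have mm: "Min (insert b A) = Min A" "Max (insert b A) = b"
      unfolding Min_insert[OF insert(1) False] Max_insert[OF insert(1) False] using b by simp_all
    show ?thesis
    proof (cases "b = Suc (Max A)")
      case True
      let ?t = "t(k := b)"
      have "insert b A = (\<Union>i\<in>{1..k}. {s i..?t i})"
      proof -
        have ins: "{1..k} = insert k {1..<k}" using k(1) by auto
        have "s k \<le> t k" using k(1,4) by auto
        moreover have "b = Suc (t k)" using True k(3) by simp
        ultimately have last: "insert b {s k..t k} = {s k..b}" by auto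
        have "insert b A = (\<Union>i\<in>{1..<k}. {s i..t i}) \<union> insert b {s k..t k}"
          unfolding k(6) ins by blast
        also have "\<dots> = (\<Union>i\<in>{1..<k}. {s i..?t i}) \<union> {s k..?t k}" unfolding last by simp
        also have "\<dots> = (\<Union>i\<in>{1..k}. {s i..?t i})" unfolding ins by blast
        finally show ?thesis .
      qed
      moreover have "\<forall>i\<in>{1..k}. s i \<le> ?t i"
        using bspec[OF k(4)] t b(1) by (fastforce intro: order.trans[of _ "Max A"])
      ultimately have "runs (insert b A) k s ?t" using k(1,2,5) mm by (simp add: runs_def)
      thus ?thesis by blast
    next
      case False
      let ?s = "s(Suc k := b)" and ?t = "t(Suc k := b)"
      have S: "{1..Suc k} = insert (Suc k) {1..k}" by auto
      have "insert b A = (\<Union>i\<in>{1..Suc k}. {?s i..?t i})" unfolding S k(6) by auto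
      moreover have "Suc (?t i) < ?s j" if "i \<in> {1..Suc k}" "j \<in> {1..Suc k}" "i < j" for i j
        using that k(5) t[of i] b False by (cases "j = Suc k") auto
      moreover have "?s i \<le> ?t i" if "i \<in> {1..Suc k}" for i using that k(4) by auto
      moreover have "?s 1 = Min A" using k(1,2) by auto
      ultimately have "runs (insert b A) (Suc k) ?s ?t" unfolding runs_def mm by auto
      thus ?thesis by blast
    qed
  qed
qed simp

lemma walk_edges_map_upt:
  "walk_edges (map f [a..<Suc b]) = (\<lambda>x. {f x, f (Suc x)}) ` {a..<b}"
proof -
  have "walk_edges (map f [a..<Suc b]) = {{f (a + i), f (Suc (a + i))} | i. i < b - a}"
    unfolding walk_edges_def by (intro Collect_cong ex_cong1) (auto simp del: upt_Suc)
  also have "\<dots> = (\<lambda>x. {f x, f (Suc x)}) ` ((+) a ` {..<b - a})" by auto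
  also have "(+) a ` {..<b - a} = {a..<b}"
  proof -
    have "x \<in> (+) a ` {..<b - a}" if "a \<le> x" "x < b" for x
      using that by (intro image_eqI[of _ _ "x - a"]) auto
    thus ?thesis by auto
  qed
  finally show ?thesis .
qed

text \<open>The extra start \<open>s (Suc k) = length e\<close> is a sentinel: the last connecting
  walk runs up to it, and reduction modulo the length turns it into position 0, the start of
  \<open>P 1\<close>.\<close>

lemma traverses_runs:
  assumes k: "1 \<le> k" and s: "s 1 = 0" "s (Suc k) = length e"
    and st: "\<And>i. i \<in> {1..k} \<Longrightarrow> s i \<le> t i \<and> t i < s (Suc i)"
    and P: "\<And>i. i \<in> {1..k} \<Longrightarrow> P i = map ((!) e) [s i..<Suc (t i)]" "P (Suc k) = P 1"
  shows "traverses e k P (\<lambda>i. map (\<lambda>x. e ! (x mod length e)) [t i..<Suc (s (Suc i))])"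
    (is "traverses e k P ?Q")
proof -
  let ?n = "length e"
  have sn: "s i \<le> ?n" if "i \<le> Suc k" "1 \<le> i" for i
    using that
  proof (induction rule: inc_induct)
    case (step i)
    thus ?case using st[of i] by auto
  qed (use s in auto)
  have tn: "t i < ?n" if "i \<in> {1..k}" for i
    using st[OF that] sn[of "Suc i"] that by auto
  have ends: "2 \<le> length (?Q i) \<and> hd (?Q i) = last (P i) \<and> last (?Q i) = hd (P (Suc i))"
    if i: "i \<in> {1..k}" for i
  proof (intro conjI)
    have ti: "t i < s (Suc i)" "s i \<le> t i" using st[OF i] by auto
    show "2 \<le> length (?Q i)" using ti by simp
    show "hd (?Q i) = last (P i)" 
    proof -
      have "hd (?Q i) = e ! (t i mod ?n)" using ti by (simp add: hd_map del: upt_Suc)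
      thus ?thesis using ti tn[OF i] P(1)[OF i] by simp
    qed
    have hdP: "hd (P j) = e ! s j" if "j \<in> {1..k}" for j
      using st[OF that] P(1)[OF that] by (simp add: hd_map del: upt_Suc)
    have "last (?Q i) = e ! (s (Suc i) mod ?n)" using ti by simp
    also have "\<dots> = hd (P (Suc i))"
    proof (cases "i = k")
      case True
      thus ?thesis using P(2) hdP[of 1] s k by simp
    next
      case False
      hence "Suc i \<in> {1..k}" using i by auto
      thus ?thesis using hdP tn[of "Suc i"] st[of "Suc i"] by simp
    qed
    finally show "last (?Q i) = hd (P (Suc i))" .
  qed
  \<comment> \<open>Without its two ends, the walk covers exactly the positions between two runs, so
    these blocks tile the whole list.\<close>
  have seg: "P i @ butlast (tl (?Q i)) = map ((!) e) [s i..<s (Suc i)]" if i: "i \<in> {1..k}" for i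
  proof -
    have ti: "t i < s (Suc i)" "s i \<le> t i" using st[OF i] by auto
    have sS: "s (Suc i) \<le> ?n" using sn[of "Suc i"] i by auto
    have "tl (?Q i) = map (\<lambda>x. e ! (x mod ?n)) [Suc (t i)..<Suc (s (Suc i))]"
      using ti by (simp add: map_tl[symmetric] del: upt_Suc)
    hence "butlast (tl (?Q i)) = map (\<lambda>x. e ! (x mod ?n)) [Suc (t i)..<s (Suc i)]"
      using ti by simp
    also have "\<dots> = map ((!) e) [Suc (t i)..<s (Suc i)]" using sS by auto
    finally have "P i @ butlast (tl (?Q i)) =
        map ((!) e) ([s i..<Suc (t i)] @ [Suc (t i)..<s (Suc i)])" using P(1)[OF i] by simp
    also have "[s i..<Suc (t i)] @ [Suc (t i)..<s (Suc i)] = [s i..<s (Suc i)]"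
      using ti upt_add_eq_append[of "s i" "Suc (t i)" "s (Suc i) - Suc (t i)"] by simp
    finally show ?thesis .
  qed
  have "concat (map (\<lambda>i. P i @ butlast (tl (?Q i))) [1..<Suc j]) = map ((!) e) [0..<s (Suc j)]"
    if "j \<le> k" for j
    using that
  proof (induction j)
    case (Suc j)
    have "s (Suc j) \<le> s (Suc (Suc j))" using st[of "Suc j"] Suc.prems by auto
    hence "[0..<s (Suc (Suc j))] = [0..<s (Suc j)] @ [s (Suc j)..<s (Suc (Suc j))]"
      using upt_add_eq_append[of 0 "s (Suc j)" "s (Suc (Suc j)) - s (Suc j)"] by simp
    thus ?case using Suc seg[of "Suc j"] by simp
  qed (use s in simp)
  from this[of k] s have "concat (map (\<lambda>i. P i @ butlast (tl (?Q i))) [1..<k + 1]) = e"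
    by (simp add: map_nth)
  thus ?thesis using ends P(2) unfolding traverses_def by simp
qed

section \<open>Assembly of the common paths and the connecting walks\<close>

theorem theorem3:
  fixes V :: "'v set" and E :: "'v set set" and M :: "'v set set set" and C1 C2 :: "'v set set"
  assumes "simple_graph V E"
    and "minimum_cycle_basis V E M"
    and "C1 \<in> M" and "C2 \<in> M" and "C1 \<noteq> C2"
    and "card C1 \<le> card C2"
    and "\<Union>C1 \<inter> \<Union>C2 \<noteq> {}"
  shows "\<exists>c1 c2. circulation C1 c1 \<and> circulation C2 c2 \<and>
    (\<exists>k P Q1 Q2. 1 \<le> k \<and>
      (\<forall>i\<in>{1..k}. is_path (C1 \<inter> C2) (P i)) \<and>
      disjoint_family_on (\<lambda>i. set (P i)) {1..k} \<and>
      (\<Union>i\<in>{1..k}. set (P i)) = \<Union>C1 \<inter> \<Union>C2 \<and>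
      (\<Union>i\<in>{1..k}. walk_edges (P i)) = C1 \<inter> C2 \<and>
      traverses c1 k P Q1 \<and> traverses c2 k P Q2 \<and>
      (\<forall>i\<in>{1..<k}. walk_length (Q1 i) = walk_length (Q2 i)) \<and>
      (\<forall>i\<in>{1..<k}. real (walk_length (Q1 i)) \<le> real (card C1) / 2 \<and>
                    real (walk_length (Q2 i)) \<le> real (card C1) / 2) \<and>
      real (walk_length (Q2 k)) = real (walk_length (Q1 k)) + real (card C2) - real (card C1) \<and>
      real (walk_length (Q1 k)) \<ge> real (card C1) / 2 \<and>
      real (walk_length (Q2 k)) \<ge> real (card C2) / 2)"
proof -
  interpret mcb V E M using assms(1,2) by unfold_locales
  obtain c d where c: "circulation C1 c" and d: "circulation C2 d" and start: "c ! 0 \<in> \<Union>C2"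
    and half: "\<And>x. x < length c \<Longrightarrow> c ! x \<in> \<Union>C2 \<Longrightarrow> 2 * x \<le> length c"
    and eq: "\<And>x. x < length c \<Longrightarrow> c ! x \<in> \<Union>C2 \<Longrightarrow> d ! x = c ! x"
    using M_aligned[OF assms(3-5,7,6)] by blast
  let ?n = "length c" and ?m = "length d"
  have card: "card C1 = ?n" "card C2 = ?m" using c d by (auto simp: circulation_card)
  have n: "3 \<le> ?n" "?n \<le> ?m" "distinct c"
    using c assms(6) card by (auto simp: circulation_def)
  define I where "I = {x. x < ?n \<and> c ! x \<in> \<Union>C2}"
  have I: "x < ?n" "2 * x \<le> ?n" "d ! x = c ! x" if "x \<in> I" for x
    using that half eq by (auto simp: I_def)
  have I0: "0 \<in> I" using start n by (auto simp: I_def)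
  have finI: "finite I" by (simp add: I_def)
  obtain k s t where "runs I k s t" using ex_runs[OF finI] I0 by blast
  hence k1: "1 \<le> k" "s 1 = Min I" and st: "\<forall>i\<in>{1..k}. s i \<le> t i"
    and gap: "\<forall>i\<in>{1..k}. \<forall>j\<in>{1..k}. i < j \<longrightarrow> Suc (t i) < s j"
    and runs: "I = (\<Union>i\<in>{1..k}. {s i..t i})"
    unfolding runs_def by blast+
  have k: "1 \<le> k" "s 1 = 0" using k1 I0 finI by (simp_all add: Min_eqI)
  have inI: "x \<in> I" if "i \<in> {1..k}" "s i \<le> x" "x \<le> t i" for i x using runs that by auto
  have tI: "t i \<in> I" "s i \<in> I" if "i \<in> {1..k}" for i using inI st that by auto
  \<comment> \<open>The index \<open>Suc k\<close> is redirected to 1, as \<open>traverses\<close>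
    requires. The same \<open>P\<close> serves \<open>d\<close>, which agrees with \<open>c\<close>
    at all positions in \<open>I\<close>.\<close>
  define P where "P i = (let j = (if i = Suc k then 1 else i) in map ((!) c) [s j..<Suc (t j)])" for i
  \<comment> \<open>The sentinel depends on the circuit, so only the last connecting walks of
    \<open>c\<close> and \<open>d\<close> can differ in length.\<close>
  define s' where "s' N = s(Suc k := N)" for N :: nat
  define Q where "Q e i = map (\<lambda>x. e ! (x mod length e)) [t i..<Suc (s' (length e) (Suc i))]"
    for e :: "'v list" and i
  have P: "P i = map ((!) c) [s i..<Suc (t i)]" if "i \<in> {1..k}" for i
    using that by (auto simp: P_def)
  have Pd: "P i = map ((!) d) [s i..<Suc (t i)]" if "i \<in> {1..k}" for i
    unfolding P[OF that] using I(3) inI[OF that] by (auto simp del: upt_Suc)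
  have Pk: "P (Suc k) = P 1" by (simp add: P_def)
  have s': "s' N i \<le> t i \<and> t i < s' N (Suc i)" if "i \<in> {1..k}" "?n \<le> N" for N i
  proof (cases "i = k")
    case True
    thus ?thesis using that st I(1)[OF tI(1)] by (fastforce simp: s'_def)
  next
    case False
    hence "Suc (t i) < s (Suc i)" using gap that by auto
    thus ?thesis using that False st by (auto simp: s'_def)
  qed
  have s1: "s' N 1 = 0" "s' N (Suc k) = N" for N using k by (auto simp: s'_def)
  have P': "P i = map ((!) e) [s' N i..<Suc (t i)]" if "i \<in> {1..k}" "e = c \<or> e = d" for i e N
    using P[OF that(1)] Pd[OF that(1)] that by (auto simp: s'_def)
  have trav: "traverses c k P (Q c)" "traverses d k P (Q d)"
    unfolding Q_def
    by (rule traverses_runs[OF k(1) s1 s' P' Pk]; use n in auto)+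
  have setP: "set (P i) = (!) c ` {s i..t i}" if "i \<in> {1..k}" for i
    unfolding P[OF that] by (auto simp del: upt_Suc)
  have "(\<Union>i\<in>{1..k}. set (P i)) = (!) c ` I" unfolding runs by (auto simp: setP)
  also have "\<dots> = \<Union>C1 \<inter> \<Union>C2"
    unfolding circulation_Union[OF c] by (auto simp: I_def in_set_conv_nth intro!: imageI)
  finally have vertices: "(\<Union>i\<in>{1..k}. set (P i)) = \<Union>C1 \<inter> \<Union>C2" .
  have "set (P i) \<inter> set (P j) = {}" if ij: "i \<in> {1..k}" "j \<in> {1..k}" "i < j" for i j
  proof -
    have "Suc (t i) < s j" using gap ij by blast
    moreover have "c ! x \<noteq> c ! y" if "x \<in> {s i..t i}" "y \<in> {s j..t j}" "x \<noteq> y" for x y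
      using that inI[OF ij(1), of x] inI[OF ij(2), of y] I(1) n(3) by (auto simp: nth_eq_iff_index_eq)
    ultimately show ?thesis using setP ij by fastforce
  qed
  hence disj: "disjoint_family_on (\<lambda>i. set (P i)) {1..k}"
    unfolding disjoint_family_on_def by (metis Int_commute linorder_neqE_nat)
  have we: "walk_edges (P i) = cyc_edge c ` {s i..<t i}" if "i \<in> {1..k}" for i
    unfolding P[OF that] walk_edges_map_upt using I(1)[OF tI(1)[OF that]]
    by (intro image_cong) (auto simp: cyc_edge_def)
  have common: "cyc_edge c x \<in> C1 \<inter> C2" if "x \<in> I" "Suc x \<in> I" for x
  proof -
    have "cyc_edge c x = cyc_edge d x" using I(1,3)[OF that(1)] I(1,3)[OF that(2)] n
      by (simp add: cyc_edge_def)
    thus ?thesis using I(1)[OF that(1)] n c d unfolding circulation_iff by auto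
  qed
  have edges: "walk_edges (P i) \<subseteq> C1 \<inter> C2" if "i \<in> {1..k}" for i
    unfolding we[OF that] using common inI[OF that] by auto
  have paths: "is_path (C1 \<inter> C2) (P i)" if i: "i \<in> {1..k}" for i
  proof -
    have "P i \<noteq> []" using P[OF i] st i by simp
    moreover have "distinct (P i)"
      unfolding P[OF i] using inI[OF i] I(1) n(3)
      by (auto simp: distinct_map inj_on_def nth_eq_iff_index_eq simp del: upt_Suc)
    ultimately show ?thesis using edges[OF i] by (simp add: is_path_def)
  qed
  have "e \<in> (\<Union>i\<in>{1..k}. walk_edges (P i))" if e: "e \<in> C1 \<inter> C2" for e
  proof -
    obtain x where x: "x < ?n" "e = cyc_edge c x" using e c by (auto simp: circulation_iff)
    have "c ! x \<in> \<Union>C2" "c ! (Suc x mod ?n) \<in> \<Union>C2" using e x by (auto simp: cyc_edge_def)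
    hence "x \<in> I" "Suc x mod ?n \<in> I" using x n by (auto simp: I_def intro!: mod_less_divisor)
    \<comment> \<open>The closing edge of \<open>c\<close> is never common:
      \<open>x = ?n - 1\<close> is beyond the first half when \<open>3 \<le> ?n\<close>.\<close>
    moreover have "Suc x < ?n" using I(2)[OF \<open>x \<in> I\<close>] n x by linarith
    ultimately have xI: "x \<in> I" "Suc x \<in> I" by auto
    then obtain i j where ij: "i \<in> {1..k}" "s i \<le> x" "x \<le> t i" "j \<in> {1..k}" "s j \<le> Suc x" "Suc x \<le> t j"
      unfolding runs by auto
    \<comment> \<open>Consecutive positions cannot belong to different runs, so the edge lies in a
      single path.\<close>
    have "Suc (t i) < s j" if "i < j" using gap ij that by blast
    moreover have "Suc (t j) < s i" if "j < i" using gap ij that by blast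
    ultimately have "i = j" using ij by (cases i j rule: linorder_cases) auto
    hence "e \<in> walk_edges (P i)" unfolding we[OF ij(1)] using ij x(2) by auto
    thus ?thesis using ij(1) by blast
  qed
  hence inter: "(\<Union>i\<in>{1..k}. walk_edges (P i)) = C1 \<inter> C2" using edges by blast
  have len: "walk_length (Q e i) = s' (length e) (Suc i) - t i" if "i \<in> {1..k}" "?n \<le> length e" for e i
    using s'[OF that] by (simp add: Q_def walk_length_def)
  have inner: "walk_length (Q c i) = walk_length (Q d i)" "2 * walk_length (Q c i) \<le> ?n"
    if "i \<in> {1..<k}" for i
  proof -
    \<comment> \<open>Before the last index the sentinel is not reached, so the length is the same
      for both circuits; it is at most \<open>s (Suc i)\<close>, which lies in the first
      half.\<close>
    have "walk_length (Q e i) = s (Suc i) - t i" if "?n \<le> length e" for e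
      using len[of i e] \<open>i \<in> {1..<k}\<close> that by (simp add: s'_def)
    moreover have "2 * s (Suc i) \<le> ?n" using I(2)[OF tI(2)[of "Suc i"]] that by auto
    ultimately show "walk_length (Q c i) = walk_length (Q d i)" "2 * walk_length (Q c i) \<le> ?n"
      using n by simp_all
  qed
  have last: "walk_length (Q c k) = ?n - t k" "walk_length (Q d k) = ?m - t k"
    using len[of k] k n s1 by auto
  \<comment> \<open>Since \<open>2 * t k \<le> ?n \<le> ?m\<close>, both \<open>?n - t k\<close> and
    \<open>?m - t k\<close> are at least half of their circuits.\<close>
  have tk: "2 * t k \<le> ?n" "t k < ?n" using I tI k by auto
  show ?thesis
  proof (rule exI[of _ c], rule exI[of _ d], intro conjI c d, rule exI[of _ k], rule exI[of _ P],
      rule exI[of _ "Q c"], rule exI[of _ "Q d"], intro conjI k(1) disj vertices inter trav)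
    show "\<forall>i\<in>{1..k}. is_path (C1 \<inter> C2) (P i)" using paths by blast
    show "\<forall>i\<in>{1..<k}. walk_length (Q c i) = walk_length (Q d i)" using inner by blast
    show "\<forall>i\<in>{1..<k}. real (walk_length (Q c i)) \<le> real (card C1) / 2 \<and>
        real (walk_length (Q d i)) \<le> real (card C1) / 2"
      using inner card by fastforce
    show "real (walk_length (Q d k)) = real (walk_length (Q c k)) + real (card C2) - real (card C1)"
      "real (walk_length (Q c k)) \<ge> real (card C1) / 2"
      "real (walk_length (Q d k)) \<ge> real (card C2) / 2"
      using tk n unfolding last card by (auto simp: of_nat_diff)
  qed
qed

end
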